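(* Let $G=(V,w)$ be a weighted undirected graph with $n$ vertices and let $A$ be its adjacency matrix. There is a randomized algorithm that finds a spanning forest of $G$ with probability at least $49/50$ after making $3(\log(n)+10)$ calls to $\mathsf{RecoverOneFromAll}[A](R,S,\delta)$ with error parameter $\delta=(300(\log(n)+10))^{-1}$. Moreover, all calls to $\mathsf{RecoverOneFromAll}$ made by the algorithm involve sets $R,S\subseteq V$ that are disjoint.
   Context: A weighted graph $G=(V,w)$ has a non-negative weight function $w$ on the 2-element subsets of $V$; its edges are the pairs of positive weight. Its adjacency matrix $A\in\mathbb{R}^{V\times V}$ has $A(u,v)=w(\{u,v\})$ for $u\neq v$ and zero diagonal. A spanning forest of $G$ is a set of edges of $G$ forming a forest whose trees span exactly the connected components of $G$. The subroutine $\mathsf{RecoverOneFromAll}[A](R,S,\delta)$ is given oracle access to a non-negative matrix $A\in\mathbb{R}^{m\times n}$, subsets $R\subseteq[m]$, $S\subseteq[n]$ and an error parameter $\delta$; with probability at least $1-\delta$ it outputs a set $\mathcal{T}\subseteq R\times S$ such that for every $i\in R$ for which there exists $j\in S$ with $A(i,j)>0$, there is a pair $(i,t)\in\mathcal{T}$ with $A(i,t)>0$. The algorithm accesses $G$ only through such calls.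
   Formalization: A correct answer T of RecoverOneFromAll is also required to contain only pairs (i,t) with A(i,t)>0; otherwise T=R×S is always a correct answer and, already for n=2, an edge cannot be told from no edge. Log is base 2, and the number of calls is rounded down. *)

theory Defs
  imports "HOL-Probability.Probability"
begin

section \<open>Weighted graphs and spanning forests\<close>

text \<open>The weight function is only meaningful on the 2-element subsets of the vertex set; its values
  elsewhere are irrelevant.\<close>

definition weighted_graph :: "'v set \<Rightarrow> ('v set \<Rightarrow> real) \<Rightarrow> bool" where
  "weighted_graph V w \<longleftrightarrow> finite V \<and> (\<forall>e. e \<subseteq> V \<and> card e = 2 \<longrightarrow> 0 \<le> w e)"

definition edges :: "'v set \<Rightarrow> ('v set \<Rightarrow> real) \<Rightarrow> 'v set set" where
  "edges V w = {e. e \<subseteq> V \<and> card e = 2 \<and> 0 < w e}"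

definition adjacency_matrix :: "('v set \<Rightarrow> real) \<Rightarrow> 'v \<Rightarrow> 'v \<Rightarrow> real" where
  "adjacency_matrix w u v = (if u = v then 0 else w {u, v})"

definition connected_in :: "'v set set \<Rightarrow> 'v \<Rightarrow> 'v \<Rightarrow> bool" where
  "connected_in E u v \<longleftrightarrow> (u, v) \<in> {(x, y). {x, y} \<in> E}\<^sup>*"

definition components_of :: "'v set \<Rightarrow> 'v set set \<Rightarrow> 'v set set" where
  "components_of V E = (\<lambda>u. {v \<in> V. connected_in E u v}) ` V"

definition is_cycle :: "'v set set \<Rightarrow> 'v list \<Rightarrow> bool" where
  "is_cycle E vs \<longleftrightarrow> 3 \<le> length vs \<and> distinct vs \<and>
     (\<forall>i < length vs. {vs ! i, vs ! (Suc i mod length vs)} \<in> E)"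

definition is_forest :: "'v set set \<Rightarrow> bool" where
  "is_forest E \<longleftrightarrow> (\<nexists>vs. is_cycle E vs)"

text \<open>The trees of \<open>(V, F)\<close> are its connected components; an isolated vertex is a one-vertex tree.\<close>

definition spanning_forest :: "'v set \<Rightarrow> ('v set \<Rightarrow> real) \<Rightarrow> 'v set set \<Rightarrow> bool" where
  "spanning_forest V w F \<longleftrightarrow>
     F \<subseteq> edges V w \<and> is_forest F \<and> components_of V F = components_of V (edges V w)"


section \<open>The subroutine RecoverOneFromAll\<close>

text \<open>The third conjunct says that the reported pairs are positions of positive entries, i.e. that
  entries are really recovered. Without it the uninformative answer \<open>R \<times> S\<close> would always be correct.\<close>

definition recovers_one_from_all ::
    "('a \<Rightarrow> 'b \<Rightarrow> real) \<Rightarrow> 'a set \<Rightarrow> 'b set \<Rightarrow> ('a \<times> 'b) set \<Rightarrow> bool" where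
  "recovers_one_from_all A R S T \<longleftrightarrow>
     T \<subseteq> R \<times> S \<and>
     (\<forall>i\<in>R. (\<exists>j\<in>S. 0 < A i j) \<longrightarrow> (\<exists>t. (i, t) \<in> T \<and> 0 < A i t)) \<and>
     (\<forall>(i, t)\<in>T. 0 < A i t)"

text \<open>A subroutine maps its arguments to the distribution of its answer. \<open>X\<close> and \<open>Y\<close> are the row and
  column indices of the matrix. On failure, the answer is arbitrary.\<close>

type_synonym ('a, 'b) subroutine = "'a set \<Rightarrow> 'b set \<Rightarrow> real \<Rightarrow> ('a \<times> 'b) set pmf"

definition RecoverOneFromAll ::
    "('a \<Rightarrow> 'b \<Rightarrow> real) \<Rightarrow> 'a set \<Rightarrow> 'b set \<Rightarrow> ('a, 'b) subroutine \<Rightarrow> bool" where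
  "RecoverOneFromAll A X Y rofa \<longleftrightarrow>
     (\<forall>R S \<delta>. R \<subseteq> X \<longrightarrow> S \<subseteq> Y \<longrightarrow> 0 < \<delta> \<longrightarrow>
        measure_pmf.prob (rofa R S \<delta>) {T. recovers_one_from_all A R S T} \<ge> 1 - \<delta>)"


section \<open>Algorithms with access to the subroutine\<close>

text \<open>A deterministic algorithm is an adaptive call tree: \<open>Call R S \<delta> k\<close> makes the call
  \<open>(R, S, \<delta>)\<close> and continues with \<open>k T\<close> if the answer is \<open>T\<close>. A randomized algorithm is a
  probability distribution on deterministic ones.\<close>

datatype 'v algorithm =
    Output "'v set set"
  | Call "'v set" "'v set" real "('v \<times> 'v) set \<Rightarrow> 'v algorithm"

type_synonym 'v randomized_algorithm = "'v algorithm pmf"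

text \<open>Different calls of the subroutine use independent randomness.\<close>

primrec run :: "('v, 'v) subroutine \<Rightarrow> 'v algorithm \<Rightarrow> 'v set set pmf" where
  "run rofa (Output F) = return_pmf F"
| "run rofa (Call R S \<delta> k) = bind_pmf (rofa R S \<delta>) (\<lambda>T. run rofa (k T))"

definition run_randomized ::
    "('v, 'v) subroutine \<Rightarrow> 'v randomized_algorithm \<Rightarrow> 'v set set pmf" where
  "run_randomized rofa alg = bind_pmf alg (run rofa)"

text \<open>Exactly \<open>m\<close> calls are made, whatever the answers are.\<close>

primrec makes_calls :: "'v algorithm \<Rightarrow> nat \<Rightarrow> bool" where
  "makes_calls (Output F) m \<longleftrightarrow> m = 0"
| "makes_calls (Call R S \<delta> k) m \<longleftrightarrow> (\<exists>m'. m = Suc m' \<and> (\<forall>T. makes_calls (k T) m'))"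

primrec all_calls :: "('v set \<Rightarrow> 'v set \<Rightarrow> real \<Rightarrow> bool) \<Rightarrow> 'v algorithm \<Rightarrow> bool" where
  "all_calls P (Output F) \<longleftrightarrow> True"
| "all_calls P (Call R S \<delta> k) \<longleftrightarrow> P R S \<delta> \<and> (\<forall>T. all_calls P (k T))"

end

theory Submission
  imports Defs
begin

text \<open>Boruvka's algorithm with random orientations. The algorithm keeps the set \<open>H\<close> of all edges
  recovered so far. In each round every component of \<open>(V, H)\<close> joins one of two sides by a fair coin
  flip (the coin of a representative vertex), and one call with these two sides as rows and columns
  reports, for each vertex on the first side, an edge to the second side if there is one. A component
  that some edge of \<open>G\<close> leaves is on the first side, with the other end of that edge on the second
  side, with probability 1/4; then it is merged into a component of the second side. So the number
  of components that some edge leaves shrinks by a factor 3/4 in expectation, and after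
  \<open>3 (log n + 10)\<close> rounds it is zero with probability at least 99/100. The union bound over all calls
  costs another 1/100.\<close>

section \<open>Components\<close>

definition component :: "'v set \<Rightarrow> 'v set set \<Rightarrow> 'v \<Rightarrow> 'v set" where
  "component V H u = {v \<in> V. connected_in H u v}"

text \<open>The potential of the algorithm. A component of \<open>(V, H)\<close> that is already a
  component of \<open>(V, E)\<close> is not counted, so the potential can reach 0.\<close>

definition open_components :: "'v set \<Rightarrow> 'v set set \<Rightarrow> 'v set set \<Rightarrow> 'v set set" where
  "open_components V E H = {C \<in> components_of V H. \<exists>i\<in>C. \<exists>j\<in>V - C. {i, j} \<in> E}"

lemma components_of_eq: "components_of V H = component V H ` V"
  by (simp add: components_of_def component_def)

section \<open>Connectivity as an equivalence relation\<close>

lemma connected_in_refl [simp]: "connected_in H u u"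
  by (simp add: connected_in_def)

lemma connected_in_edge: "{u, v} \<in> H \<Longrightarrow> connected_in H u v"
  by (auto simp: connected_in_def)

lemma connected_in_trans: "connected_in H u v \<Longrightarrow> connected_in H v x \<Longrightarrow> connected_in H u x"
  by (auto simp: connected_in_def)

lemma connected_in_sym: "connected_in H u v \<Longrightarrow> connected_in H v u"
proof -
  have "sym {(x, y). {x, y} \<in> H}"
    by (auto simp: sym_def insert_commute)
  then have "sym ({(x, y). {x, y} \<in> H}\<^sup>*)"
    by (rule sym_rtrancl)
  then show "connected_in H u v \<Longrightarrow> connected_in H v u"
    by (auto simp: connected_in_def sym_def)
qed

text \<open>Each edge of a path in \<open>H\<close> is replaced by a path in \<open>H'\<close>. This
  serves both to enlarge an edge set and to delete an edge of a cycle.\<close>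

lemma connected_in_subst:
  assumes "connected_in H u v" and "\<And>x y. {x, y} \<in> H \<Longrightarrow> connected_in H' x y"
  shows "connected_in H' u v"
  using assms(1) unfolding connected_in_def
proof (induction rule: rtrancl_induct)
  case base
  then show ?case by simp
next
  case (step y z)
  then show ?case
    using assms(2)[of y z] by (auto simp: connected_in_def)
qed

lemma connected_in_mono: "connected_in H u v \<Longrightarrow> H \<subseteq> H' \<Longrightarrow> connected_in H' u v"
  by (erule connected_in_subst) (auto intro: connected_in_edge)

lemma connected_in_closed:
  assumes "connected_in H u v" and "u \<in> C" and "\<And>x y. x \<in> C \<Longrightarrow> {x, y} \<in> H \<Longrightarrow> y \<in> C"
  shows "v \<in> C"
  using assms(1) unfolding connected_in_def
  by (induction rule: rtrancl_induct) (use assms(2,3) in auto)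

lemma component_cong: "connected_in H u v \<Longrightarrow> component V H u = component V H v"
  unfolding component_def by (auto intro: connected_in_trans dest: connected_in_sym)

lemma components_of_memD:
  assumes "C \<in> components_of V H" and "x \<in> C"
  shows "x \<in> V" and "C = component V H x"
proof -
  from assms(1) obtain u where u: "u \<in> V" "C = component V H u"
    by (auto simp: components_of_eq)
  with assms(2) have x: "x \<in> V" "connected_in H u x"
    by (auto simp: component_def)
  show "x \<in> V" by fact
  show "C = component V H x"
    using u component_cong[OF x(2)] by simp
qed

lemma component_in_components_of: "u \<in> V \<Longrightarrow> component V H u \<in> components_of V H"
  by (simp add: components_of_eq)

lemma self_in_component: "u \<in> V \<Longrightarrow> u \<in> component V H u"
  by (simp add: component_def)

section \<open>Counting open components\<close>

lemma finite_open_components: "finite V \<Longrightarrow> finite (open_components V E H)"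
  by (simp add: open_components_def components_of_eq)

lemma card_open_components_le: "finite V \<Longrightarrow> card (open_components V E H) \<le> card V"
proof -
  assume V: "finite V"
  then have "card (open_components V E H) \<le> card (component V H ` V)"
    by (intro card_mono) (auto simp: open_components_def components_of_eq)
  also have "\<dots> \<le> card V"
    using V by (rule card_image_le)
  finally show ?thesis .
qed

text \<open>Every edge of \<open>H'\<close> is in \<open>E\<close>, and no edge of \<open>E\<close>
  leaves the component, so no path in \<open>H'\<close> does either.\<close>

lemma component_eq_of_not_open:
  assumes E: "\<And>e. e \<in> E \<Longrightarrow> e \<subseteq> V" and H: "H \<subseteq> H'" "H' \<subseteq> E"
    and u: "u \<in> V" and closed: "component V H u \<notin> open_components V E H"
  shows "component V H' u = component V H u"
proof
  show "component V H u \<subseteq> component V H' u"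
    using connected_in_mono[OF _ H(1)] by (auto simp: component_def)
  show "component V H' u \<subseteq> component V H u"
  proof
    fix v assume "v \<in> component V H' u"
    then have "connected_in H' u v" by (simp add: component_def)
    then show "v \<in> component V H u"
    proof (rule connected_in_closed)
      show "u \<in> component V H u" using u by (rule self_in_component)
      fix x y assume x: "x \<in> component V H u" and "{x, y} \<in> H'"
      with H have e: "{x, y} \<in> E" by auto
      with E have "y \<in> V" by blast
      with e x closed component_in_components_of[OF u] show "y \<in> component V H u"
        by (auto simp: open_components_def)
    qed
  qed
qed

lemma components_of_eq_if_no_open:
  assumes "\<And>e. e \<in> E \<Longrightarrow> e \<subseteq> V" and "H \<subseteq> E" and "open_components V E H = {}"
  shows "components_of V H = components_of V E"
  unfolding components_of_eq
proof (rule image_cong[OF refl])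
  fix u assume "u \<in> V"
  then show "component V H u = component V E u"
    using component_eq_of_not_open[of E V H E u] assms by auto
qed

text \<open>Every component in \<open>M\<close> is absorbed by one outside \<open>M\<close>, so
  those outside \<open>M\<close> suffice to name all open components of \<open>H'\<close>. If the
  partner of \<open>i\<close> could lie in \<open>M\<close>, links might close up within
  \<open>M\<close>, and the count could drop by less than \<open>card M\<close>.\<close>

lemma card_open_components_merge:
  assumes V: "finite V" and E: "\<And>e. e \<in> E \<Longrightarrow> e \<subseteq> V" and H: "H \<subseteq> H'" "H' \<subseteq> E"
    and M: "M \<subseteq> open_components V E H"
    and merge: "\<And>C. C \<in> M \<Longrightarrow> \<exists>i\<in>C. \<exists>t\<in>V. component V H t \<notin> M \<and> {i, t} \<in> H'"
  shows "card (open_components V E H') + card M \<le> card (open_components V E H)"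
proof -
  \<comment> \<open>The union gives the component of \<open>H'\<close> around \<open>C\<close>
    without choosing an element of \<open>C\<close>.\<close>
  define g where "g C = (\<Union>x\<in>C. component V H' x)" for C
  have g: "g (component V H u) = component V H' u" if "u \<in> V" for u
  proof -
    have "component V H' x = component V H' u" if "x \<in> component V H u" for x
    proof (rule component_cong)
      show "connected_in H' x u"
        using that H(1) by (auto simp: component_def intro: connected_in_mono connected_in_sym)
    qed
    then have "g (component V H u) = (\<Union>x\<in>component V H u. component V H' u)"
      unfolding g_def by (rule SUP_cong[OF refl])
    then show ?thesis
      using self_in_component[OF that] by auto
  qed
  have "open_components V E H' \<subseteq> g ` (open_components V E H - M)"
  proof
    fix C' assume C': "C' \<in> open_components V E H'"
    then obtain u where u: "u \<in> V" "C' = component V H' u"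
      by (auto simp: open_components_def components_of_eq)
    have "\<exists>t\<in>V. component V H t \<notin> M \<and> C' = component V H' t"
    proof (cases "component V H u \<in> M")
      case True
      then obtain i t where it: "i \<in> component V H u" "t \<in> V" "component V H t \<notin> M" "{i, t} \<in> H'"
        using merge by blast
      have "connected_in H' u i"
        using it(1) H(1) by (auto simp: component_def intro: connected_in_mono)
      then have "connected_in H' u t"
        using connected_in_edge[OF it(4)] by (rule connected_in_trans)
      with u it show ?thesis
        using component_cong by metis
    qed (use u in blast)
    then obtain t where t: "t \<in> V" "component V H t \<notin> M" "C' = component V H' t"
      by blast
    \<comment> \<open>A component that no edge of \<open>E\<close> leaves would be unchanged in
      \<open>H'\<close>, and \<open>C'\<close> would not be open.\<close>
    have "component V H t \<in> open_components V E H"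
    proof (rule ccontr)
      assume not_open: "component V H t \<notin> open_components V E H"
      then have "component V H' t = component V H t"
        using component_eq_of_not_open[OF E H t(1)] by blast
      with t C' not_open component_in_components_of[OF t(1), of H] show False
        by (auto simp: open_components_def)
    qed
    with t g[OF t(1)] show "C' \<in> g ` (open_components V E H - M)"
      by auto
  qed
  then have "card (open_components V E H') \<le> card (open_components V E H - M)"
    using finite_open_components[OF V] by (meson finite_Diff surj_card_le)
  also have "\<dots> = card (open_components V E H) - card M"
    using M finite_open_components[OF V] by (meson card_Diff_subset finite_subset)
  finally show ?thesis
    using card_mono[OF finite_open_components[OF V] M] by linarith
qed


section \<open>Spanning forests of an edge set\<close>

text \<open>The edge \<open>e\<close> closes the cycle from the last vertex to the first; the other
  edges form a path between its ends that avoids \<open>e\<close>.\<close>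

lemma connected_in_cycle_minus:
  assumes "is_cycle F vs"
  defines "e \<equiv> {vs ! (length vs - 1), vs ! 0}"
  shows "e \<in> F" and "connected_in (F - {e}) (vs ! 0) (vs ! (length vs - 1))"
proof -
  have len: "3 \<le> length vs" and dist: "distinct vs"
    and ed: "\<And>i. i < length vs \<Longrightarrow> {vs ! i, vs ! (Suc i mod length vs)} \<in> F"
    using assms(1) by (auto simp: is_cycle_def)
  have "Suc (length vs - 1) = length vs"
    using len by simp
  with ed[of "length vs - 1"] len show "e \<in> F"
    by (simp add: e_def)
  have "vs \<noteq> []"
    using len by auto
  have "connected_in (F - {e}) (vs ! 0) (vs ! k)" if "k < length vs" for k
    using that
  proof (induction k)
    case 0
    then show ?case by simp
  next
    case (Suc k)
    have "{vs ! k, vs ! Suc k} \<in> F"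
      using ed[of k] Suc.prems by simp
    \<comment> \<open>As the vertices are distinct, equality would force \<open>k = 0\<close> and
      \<open>Suc k = length vs - 1\<close>, a cycle of length 2.\<close>
    moreover have "{vs ! k, vs ! Suc k} \<noteq> e"
    proof
      assume "{vs ! k, vs ! Suc k} = e"
      then have "vs ! Suc k \<in> {vs ! (length vs - 1), vs ! 0}" "vs ! k \<in> {vs ! (length vs - 1), vs ! 0}"
        unfolding e_def by blast+
      moreover have "vs ! Suc k \<noteq> vs ! 0" "vs ! k \<noteq> vs ! (length vs - 1)"
        using Suc.prems len \<open>vs \<noteq> []\<close> nth_eq_iff_index_eq[OF dist, of "Suc k" 0]
          nth_eq_iff_index_eq[OF dist, of k "length vs - 1"] by auto
      ultimately have "vs ! Suc k = vs ! (length vs - 1)" "vs ! k = vs ! 0"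
        by auto
      then have "Suc k = length vs - 1" "k = 0"
        using Suc.prems len \<open>vs \<noteq> []\<close> nth_eq_iff_index_eq[OF dist, of "Suc k" "length vs - 1"]
          nth_eq_iff_index_eq[OF dist, of k 0] by auto
      with len show False by simp
    qed
    ultimately have "connected_in (F - {e}) (vs ! k) (vs ! Suc k)"
      by (intro connected_in_edge) simp
    with Suc show ?case
      by (auto intro: connected_in_trans)
  qed
  then show "connected_in (F - {e}) (vs ! 0) (vs ! (length vs - 1))"
    using len by simp
qed

text \<open>A smallest subset of \<open>H\<close> with the same connectivity has no cycle, since
  deleting an edge of a cycle disconnects nothing.\<close>

lemma spanning_subforest_exists:
  assumes "finite H"
  shows "\<exists>F\<subseteq>H. is_forest F \<and> components_of V F = components_of V H"
proof -
  let ?P = "\<lambda>F. F \<subseteq> H \<and> (\<forall>x y. connected_in H x y \<longrightarrow> connected_in F x y)"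
  obtain F where F: "?P F" and least: "\<And>F'. ?P F' \<Longrightarrow> card F \<le> card F'"
    using ex_has_least_nat[of ?P H card] by auto
  have "is_forest F"
    unfolding is_forest_def
  proof
    assume "\<exists>vs. is_cycle F vs"
    then obtain vs where "is_cycle F vs" ..
    then obtain a b where ab: "{a, b} \<in> F" "connected_in (F - {{a, b}}) b a"
      using connected_in_cycle_minus by metis
    have "connected_in (F - {{a, b}}) x y" if "connected_in F x y" for x y
      using that
    proof (rule connected_in_subst)
      fix x y assume xy: "{x, y} \<in> F"
      show "connected_in (F - {{a, b}}) x y"
      proof (cases "{x, y} = {a, b}")
        case True
        then have "x = a \<and> y = b \<or> x = b \<and> y = a"
          by (auto simp: doubleton_eq_iff)
        with ab(2) show ?thesis
          by (auto intro: connected_in_sym)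
      qed (use xy in \<open>auto intro: connected_in_edge\<close>)
    qed
    with F have "?P (F - {{a, b}})" by blast
    then have "card F \<le> card (F - {{a, b}})" by (rule least)
    moreover have "finite F"
      using F assms finite_subset by blast
    ultimately show False
      using ab(1) by (metis card_Diff1_less not_less)
  qed
  moreover have "connected_in F = connected_in H"
    using F by (intro ext) (auto intro: connected_in_mono)
  then have "components_of V F = components_of V H"
    by (simp add: components_of_def)
  ultimately show ?thesis
    using F by blast
qed

text \<open>The choice depends on \<open>V\<close> and \<open>H\<close> alone, not on the weights,
  so the algorithm may output it without further access to the graph.\<close>

definition some_forest :: "'v set \<Rightarrow> 'v set set \<Rightarrow> 'v set set" where
  "some_forest V H = (SOME F. F \<subseteq> H \<and> is_forest F \<and> components_of V F = components_of V H)"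

lemma spanning_forest_some_forest:
  assumes "finite V" and H: "H \<subseteq> edges V w" and "open_components V (edges V w) H = {}"
  shows "spanning_forest V w (some_forest V H)"
proof -
  have "finite H"
    using assms(1) H finite_subset[of H "Pow V"] by (auto simp: edges_def)
  then have "some_forest V H \<subseteq> H \<and> is_forest (some_forest V H) \<and>
      components_of V (some_forest V H) = components_of V H"
    unfolding some_forest_def by (rule someI_ex[OF spanning_subforest_exists])
  moreover have "components_of V H = components_of V (edges V w)"
    by (rule components_of_eq_if_no_open[OF _ H assms(3)]) (auto simp: edges_def)
  ultimately show ?thesis
    using H by (auto simp: spanning_forest_def)
qed


section \<open>One round\<close>

definition rep :: "'v set \<Rightarrow> 'v set set \<Rightarrow> 'v \<Rightarrow> 'v" where
  "rep V H v = (SOME x. x \<in> component V H v)"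

text \<open>\<open>U\<close> is the set of vertices whose coin shows heads. Reading the coin at the
  representative keeps each component on one side, while the coins themselves can be drawn without
  knowing \<open>H\<close>.\<close>

definition heads :: "'v set \<Rightarrow> 'v set set \<Rightarrow> 'v set \<Rightarrow> 'v set" where
  "heads V H U = {v \<in> V. rep V H v \<in> U}"

definition add_pairs :: "'v set set \<Rightarrow> ('v \<times> 'v) set \<Rightarrow> 'v set set" where
  "add_pairs H T = H \<union> (\<lambda>(i, t). {i, t}) ` T"

text \<open>This does not depend on the answer \<open>T\<close>, so its size can be averaged over
  the coins apart from the randomness of the subroutine.\<close>

definition merging :: "'v set \<Rightarrow> 'v set set \<Rightarrow> 'v set set \<Rightarrow> 'v set \<Rightarrow> 'v set set" where
  "merging V E H U = {C \<in> open_components V E H.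
     \<exists>i\<in>C \<inter> heads V H U. \<exists>j\<in>V - heads V H U. {i, j} \<in> E}"

lemma rep_in_component: "v \<in> V \<Longrightarrow> rep V H v \<in> component V H v"
  unfolding rep_def by (rule someI) (rule self_in_component)

lemma rep_cong: "component V H u = component V H v \<Longrightarrow> rep V H u = rep V H v"
  by (simp add: rep_def)

lemma rep_inj:
  assumes "u \<in> V" "v \<in> V" "rep V H u = rep V H v"
  shows "component V H u = component V H v"
proof -
  have "component V H x = component V H (rep V H x)" if "x \<in> V" for x
    using component_in_components_of[OF that] rep_in_component[OF that]
    by (rule components_of_memD(2))
  from this[OF assms(1)] this[OF assms(2)] assms(3) show ?thesis by simp
qed

text \<open>A vertex \<open>i\<close> that puts \<open>C\<close> into \<open>merging\<close> has a
  positive entry among the columns, so \<open>T\<close> contains some \<open>(i, t)\<close>. The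
  whole component of \<open>t\<close> lies on the column side and is thus not in
  \<open>merging\<close>, as \<open>card_open_components_merge\<close> demands.\<close>

lemma round_progress:
  assumes V: "finite V" and H: "H \<subseteq> edges V w"
    and T: "recovers_one_from_all (adjacency_matrix w) (heads V H U) (V - heads V H U) T"
  defines "E \<equiv> edges V w"
  shows "add_pairs H T \<subseteq> E"
    and "card (open_components V E (add_pairs H T)) + card (merging V E H U)
       \<le> card (open_components V E H)"
proof -
  have T_sub: "T \<subseteq> heads V H U \<times> (V - heads V H U)"
    and T_pos: "\<And>i t. (i, t) \<in> T \<Longrightarrow> 0 < adjacency_matrix w i t"
    and T_all: "\<And>i j. i \<in> heads V H U \<Longrightarrow> j \<in> V - heads V H U \<Longrightarrow> 0 < adjacency_matrix w i j \<Longrightarrow>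
      \<exists>t. (i, t) \<in> T"
    using T unfolding recovers_one_from_all_def by blast+
  have "{i, t} \<in> E" if "(i, t) \<in> T" for i t
  proof -
    from that T_sub have "i \<in> V" "t \<in> V" "i \<noteq> t"
      by (auto simp: heads_def)
    with T_pos[OF that] show ?thesis
      by (auto simp: E_def edges_def adjacency_matrix_def)
  qed
  with H show sub: "add_pairs H T \<subseteq> E"
    by (auto simp: add_pairs_def E_def)
  show "card (open_components V E (add_pairs H T)) + card (merging V E H U)
       \<le> card (open_components V E H)"
  proof (rule card_open_components_merge[OF V _ _ sub])
    show "e \<subseteq> V" if "e \<in> E" for e
      using that by (simp add: E_def edges_def)
    show "H \<subseteq> add_pairs H T"
      by (simp add: add_pairs_def)
    show "merging V E H U \<subseteq> open_components V E H"
      by (auto simp: merging_def)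
    fix C assume "C \<in> merging V E H U"
    then obtain i j where i: "i \<in> C" "i \<in> heads V H U" and j: "j \<in> V - heads V H U"
      and e: "{i, j} \<in> E"
      by (auto simp: merging_def)
    from i j have "i \<noteq> j" by auto
    with e have "0 < adjacency_matrix w i j"
      by (simp add: E_def edges_def adjacency_matrix_def)
    then obtain t where t: "(i, t) \<in> T"
      using T_all[OF i(2) j] by blast
    with T_sub have t': "t \<in> V - heads V H U" by auto
    have "component V H t \<notin> merging V E H U"
    proof
      assume "component V H t \<in> merging V E H U"
      then obtain x where x: "x \<in> component V H t" "x \<in> heads V H U"
        by (auto simp: merging_def)
      have "component V H t \<in> components_of V H"
        using t' by (simp add: component_in_components_of)
      then have "component V H t = component V H x"
        using x(1) by (rule components_of_memD(2))
      then have "rep V H t = rep V H x" by (rule rep_cong)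
      with x t' show False by (simp add: heads_def)
    qed
    moreover have "{i, t} \<in> add_pairs H T"
      using t by (auto simp: add_pairs_def)
    ultimately show "\<exists>i\<in>C. \<exists>t\<in>V. component V H t \<notin> merging V E H U \<and> {i, t} \<in> add_pairs H T"
      using i t' by blast
  qed
qed

section \<open>Averaging over the coins\<close>

lemma card_Pow_separating:
  assumes "finite V" "x \<in> V" "y \<in> V" "x \<noteq> y"
  shows "4 * card {U \<in> Pow V. x \<in> U \<and> y \<notin> U} = 2 ^ card V"
proof -
  \<comment> \<open>Two coins are prescribed and the other \<open>card V - 2\<close> are free, hence
    the factor 4.\<close>
  have "bij_betw (insert x) (Pow (V - {x, y})) {U \<in> Pow V. x \<in> U \<and> y \<notin> U}"
    by (rule bij_betw_byWitness[where f' = "\<lambda>U. U - {x}"]) (use assms in auto)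
  then have "card {U \<in> Pow V. x \<in> U \<and> y \<notin> U} = card (Pow (V - {x, y}))"
    by (simp add: bij_betw_same_card)
  also have "\<dots> = 2 ^ card (V - {x, y})"
    using assms by (simp add: card_Pow)
  finally have *: "card {U \<in> Pow V. x \<in> U \<and> y \<notin> U} = 2 ^ card (V - {x, y})" .
  have "card V = card (V - {x, y}) + card {x, y}"
    using assms by (metis card_Un_disjoint Diff_disjoint Un_Diff_cancel2 empty_subsetI finite_Diff
        finite.emptyI finite.insertI inf_commute insert_subset sup.absorb1)
  with assms(4) have "card V = Suc (Suc (card (V - {x, y})))" by simp
  with * show ?thesis by simp
qed

text \<open>Double counting of pairs of a component and a coin set: fixing one edge that leaves an
  open component shows that at least a quarter of all coin sets make it merge.\<close>

lemma sum_card_merging: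
  assumes V: "finite V"
  shows "card (open_components V E H) * 2 ^ card V \<le> 4 * (\<Sum>U\<in>Pow V. card (merging V E H U))"
proof -
  let ?O = "open_components V E H"
  have "2 ^ card V \<le> 4 * card {U \<in> Pow V. C \<in> merging V E H U}" if C: "C \<in> ?O" for C
  proof -
    from C obtain i j where ij: "C \<in> components_of V H" "i \<in> C" "j \<in> V - C" "{i, j} \<in> E"
      by (auto simp: open_components_def)
    from components_of_memD[OF ij(1,2)] have i: "i \<in> V" "C = component V H i" .
    \<comment> \<open>Since \<open>j\<close> lies outside \<open>C\<close>, the two sides are
      decided by two different coins.\<close>
    have "rep V H i \<noteq> rep V H j"
      using rep_inj[of i V j H] i ij(3) self_in_component[of j V H] by auto
    moreover have "rep V H i \<in> V" "rep V H j \<in> V"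
      using i ij(3) rep_in_component[of _ V H] by (auto simp: component_def)
    ultimately have "2 ^ card V = 4 * card {U \<in> Pow V. rep V H i \<in> U \<and> rep V H j \<notin> U}"
      using card_Pow_separating[OF V] by metis
    also have "\<dots> \<le> 4 * card {U \<in> Pow V. C \<in> merging V E H U}"
      by (intro mult_left_mono card_mono)
        (use V C i ij in \<open>auto simp: merging_def heads_def\<close>)
    finally show ?thesis .
  qed
  then have "card ?O * 2 ^ card V \<le> (\<Sum>C\<in>?O. 4 * card {U \<in> Pow V. C \<in> merging V E H U})"
    using sum_mono[of ?O "\<lambda>_. 2 ^ card V :: nat"] by (simp del: Pow_iff)
  also have "\<dots> = 4 * (\<Sum>C\<in>?O. card {U \<in> Pow V. C \<in> merging V E H U})"
    by (simp add: sum_distrib_left)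
  also have "(\<Sum>C\<in>?O. card {U \<in> Pow V. C \<in> merging V E H U})
      = (\<Sum>U\<in>Pow V. card {C \<in> ?O. C \<in> merging V E H U})"
    by (rule sum_multicount_gen) (use V finite_open_components in auto)
  also have "\<dots> = (\<Sum>U\<in>Pow V. card (merging V E H U))"
    by (intro sum.cong refl arg_cong[of _ _ card]) (auto simp: merging_def)
  finally show ?thesis .
qed


section \<open>The algorithm\<close>

text \<open>The coins of all rounds are an argument, so each value is a deterministic call tree.
  There is no early exit, because the number of calls must not depend on the answers.\<close>

primrec boruvka :: "'v set \<Rightarrow> real \<Rightarrow> 'v set list \<Rightarrow> 'v set set \<Rightarrow> 'v algorithm" where
  "boruvka V \<delta> [] H = Output (some_forest V H)"
| "boruvka V \<delta> (U # Us) H =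
     Call (heads V H U) (V - heads V H U) \<delta> (\<lambda>T. boruvka V \<delta> Us (add_pairs H T))"

lemma makes_calls_boruvka: "makes_calls (boruvka V \<delta> Us H) (length Us)"
  by (induction Us arbitrary: H) auto

lemma all_calls_boruvka:
  "all_calls (\<lambda>R S \<delta>'. R \<subseteq> V \<and> S \<subseteq> V \<and> R \<inter> S = {} \<and> \<delta>' = \<delta>) (boruvka V \<delta> Us H)"
  by (induction Us arbitrary: H) (auto simp: heads_def)

section \<open>Error probability\<close>

lemma prob_bind_pmf:
  "measure_pmf.prob (bind_pmf p f) A = (\<integral>x. measure_pmf.prob (f x) A \<partial>measure_pmf p)"
proof -
  \<comment> \<open>The event becomes the point \<open>True\<close> of a Boolean distribution, so
    that \<open>pmf_bind\<close> applies.\<close>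
  have *: "measure_pmf.prob q A = pmf (map_pmf (\<lambda>x. x \<in> A) q) True" for q
    by (simp add: pmf_map vimage_def)
  show ?thesis
    unfolding * map_bind_pmf pmf_bind ..
qed

text \<open>Union bound: where \<open>P\<close> fails, the inner probability is at most 1, which
  costs at most \<open>\<delta>\<close> on average.\<close>

lemma prob_bind_pmf_le:
  assumes good: "\<And>x. P x \<Longrightarrow> measure_pmf.prob (f x) A \<le> c" and "0 \<le> c"
    and bad: "measure_pmf.prob p {x. P x} \<ge> 1 - \<delta>"
  shows "measure_pmf.prob (bind_pmf p f) A \<le> \<delta> + c"
proof -
  have ind: "integrable (measure_pmf p) (indicat_real {x. \<not> P x})"
    by (intro measure_pmf.integrable_const_bound[of _ 1]) auto
  then have int: "integrable (measure_pmf p) (\<lambda>x. indicator {x. \<not> P x} x + c)"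
    by simp
  have "measure_pmf.prob (bind_pmf p f) A
      \<le> (\<integral>x. indicator {x. \<not> P x} x + c \<partial>measure_pmf p)"
    unfolding prob_bind_pmf
  proof (rule integral_mono[OF _ int])
    show "integrable (measure_pmf p) (\<lambda>x. measure_pmf.prob (f x) A)"
      by (intro measure_pmf.integrable_const_bound[of _ 1]) auto
    fix x
    show "measure_pmf.prob (f x) A \<le> indicator {x. \<not> P x} x + c"
      using good[of x] assms(2) by (auto simp: indicator_def intro: add_increasing2)
  qed
  also have "\<dots> = measure_pmf.prob p {x. \<not> P x} + c"
    using ind by simp
  also have "measure_pmf.prob p {x. \<not> P x} = 1 - measure_pmf.prob p {x. P x}"
    using measure_pmf.prob_compl[of "{x. P x}" p] by (simp add: Compl_eq_Diff_UNIV[symmetric] Collect_neg_eq)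
  finally show ?thesis
    using bad by linarith
qed

text \<open>The first summand collects the failures of the calls. The second bounds the expected
  number of open components left, and so, by Markov's inequality, the probability that any is
  left.\<close>

lemma boruvka_failure:
  assumes V: "finite V" and \<delta>: "0 < \<delta>"
    and rofa: "RecoverOneFromAll (adjacency_matrix w) V V rofa"
    and H: "H \<subseteq> edges V w"
  shows "measure_pmf.prob
      (bind_pmf (replicate_pmf k (pmf_of_set (Pow V))) (\<lambda>Us. run rofa (boruvka V \<delta> Us H)))
      {F. \<not> spanning_forest V w F}
    \<le> k * \<delta> + (3 / 4) ^ k * card (open_components V (edges V w) H)"
  using H
proof (induction k arbitrary: H)
  case 0
  let ?O = "open_components V (edges V w) H"
  show ?case
  proof (cases "?O = {}")
    case True
    then show ?thesis
      using spanning_forest_some_forest[OF V 0] by (simp add: bind_return_pmf)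
  next
    case False
    \<comment> \<open>Markov's inequality in its trivial case: an open component makes the bound at
      least 1.\<close>
    then have "1 \<le> real (card ?O)"
      using finite_open_components[OF V] by (simp add: Suc_le_eq card_gt_0_iff)
    then show ?thesis
      by (intro order_trans[OF measure_pmf.prob_le_1]) simp
  qed
next
  case (Suc k)
  let ?E = "edges V w"
  let ?bad = "{F. \<not> spanning_forest V w F}"
  let ?a = "card (open_components V ?E H)"
  define rest where "rest H = bind_pmf (replicate_pmf k (pmf_of_set (Pow V)))
    (\<lambda>Us. run rofa (boruvka V \<delta> Us H))" for H
  define round where "round U = bind_pmf (rofa (heads V H U) (V - heads V H U) \<delta>)
    (\<lambda>T. rest (add_pairs H T))" for U
  \<comment> \<open>The coins of later rounds are drawn before the current answer. Being independent
    of it, they may be drawn after it, and the induction hypothesis applies to each answer.\<close>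
  have commute: "bind_pmf (replicate_pmf k q) (\<lambda>Us. bind_pmf p (\<lambda>T. f T Us))
      = bind_pmf p (\<lambda>T. bind_pmf (replicate_pmf k q) (f T))"
    for q :: "'a set pmf" and p :: "('a \<times> 'a) set pmf" and f :: "_ \<Rightarrow> _ \<Rightarrow> 'a set set pmf"
    by (rule bind_commute_pmf)
  have split: "bind_pmf (replicate_pmf (Suc k) (pmf_of_set (Pow V)))
      (\<lambda>Us. run rofa (boruvka V \<delta> Us H)) = bind_pmf (pmf_of_set (Pow V)) round"
    unfolding round_def rest_def
    by (simp add: bind_assoc_pmf bind_return_pmf commute)
  let ?m = "\<lambda>U. card (merging V ?E H U)"
  \<comment> \<open>The bound for the remaining rounds after a correct answer, which removes at
    least \<open>?m U\<close> open components.\<close>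
  let ?c = "\<lambda>U. k * \<delta> + (3 / 4) ^ k * (real ?a - real (?m U))"
  have round_le: "measure_pmf.prob (round U) ?bad \<le> \<delta> + ?c U" for U
    unfolding round_def
  proof (rule prob_bind_pmf_le)
    let ?good = "recovers_one_from_all (adjacency_matrix w) (heads V H U) (V - heads V H U)"
    show "measure_pmf.prob (rofa (heads V H U) (V - heads V H U) \<delta>) {T. ?good T} \<ge> 1 - \<delta>"
      using rofa \<delta> by (simp add: RecoverOneFromAll_def heads_def)
    have "?m U \<le> ?a"
      by (intro card_mono finite_open_components V) (auto simp: merging_def)
    then show "0 \<le> ?c U"
      using \<delta> by simp
    fix T assume "?good T"
    note progress = round_progress[OF V Suc.prems this]
    have "measure_pmf.prob (rest (add_pairs H T)) ?bad
        \<le> k * \<delta> + (3 / 4) ^ k * card (open_components V ?E (add_pairs H T))"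
      unfolding rest_def by (rule Suc.IH[OF progress(1)])
    also have "\<dots> \<le> ?c U"
      using progress(2) by (intro add_left_mono mult_left_mono) auto
    finally show "measure_pmf.prob (rest (add_pairs H T)) ?bad \<le> ?c U" .
  qed
  have card_Pow_V: "real (card (Pow V)) = 2 ^ card V"
    using V by (simp add: card_Pow)
  have "real ?a * 2 ^ card V \<le> 4 * (\<Sum>U\<in>Pow V. real (?m U))"
    using sum_card_merging[OF V, of ?E H] by (simp flip: of_nat_sum of_nat_le_iff[where 'a = real])
  then have drop: "real ?a / 4 \<le> (\<Sum>U\<in>Pow V. real (?m U)) / 2 ^ card V"
    by (simp add: field_simps)
  have "measure_pmf.prob (bind_pmf (pmf_of_set (Pow V)) round) ?bad
      = (\<Sum>U\<in>Pow V. measure_pmf.prob (round U) ?bad) / card (Pow V)"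
    unfolding prob_bind_pmf by (rule integral_pmf_of_set) (use V in auto)
  also have "\<dots> \<le> (\<Sum>U\<in>Pow V. \<delta> + ?c U) / card (Pow V)"
    by (intro divide_right_mono sum_mono round_le) simp
  also have "(\<Sum>U\<in>Pow V. \<delta> + ?c U)
      = 2 ^ card V * (Suc k * \<delta> + (3 / 4) ^ k * ?a) - (3 / 4) ^ k * (\<Sum>U\<in>Pow V. real (?m U))"
    by (simp add: sum.distrib sum_subtractf sum_distrib_left card_Pow_V algebra_simps
        del: of_nat_sum card_Pow)
  also have "\<dots> / card (Pow V)
      = Suc k * \<delta> + (3 / 4) ^ k * (?a - (\<Sum>U\<in>Pow V. real (?m U)) / 2 ^ card V)"
    unfolding card_Pow_V by (simp add: field_simps)
  \<comment> \<open>On average a quarter of the open components merge; this is the source of the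
    factor 3/4.\<close>
  also have "\<dots> \<le> Suc k * \<delta> + (3 / 4) ^ k * (?a - real ?a / 4)"
    using drop by (intro add_left_mono mult_left_mono diff_left_mono) auto
  also have "\<dots> = Suc k * \<delta> + (3 / 4) ^ Suc k * ?a"
    by simp
  finally show ?case
    unfolding split .
qed

text \<open>Three rounds more than halve the bound, as 27/64 < 1/2, so \<open>3 * L\<close> rounds
  cancel the factor \<open>n\<close>. The constant number of extra rounds gives 1/100.\<close>

lemma rounds_suffice:
  fixes n :: nat
  shows "(3 / 4) ^ nat \<lfloor>3 * (log 2 (real n) + 10)\<rfloor> * real n \<le> 1 / 100"
proof (cases "n = 0")
  case False
  define L where "L = log 2 (real n)"
  define K where "K = nat \<lfloor>3 * (L + 10)\<rfloor>"
  have L: "0 \<le> L" "2 powr L = real n"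
    using False by (auto simp: L_def)
  \<comment> \<open>Rounding down loses less than one round, so 29 of the 30 extra rounds are
    certain.\<close>
  have K: "3 * L + 29 \<le> real K"
  proof -
    have "0 \<le> \<lfloor>3 * (L + 10)\<rfloor>"
      using L(1) by simp
    then have "real K = of_int \<lfloor>3 * (L + 10)\<rfloor>"
      by (simp add: K_def)
    then have "3 * (L + 10) < real K + 1"
      by (simp only: real_of_int_floor_add_one_gt)
    then show ?thesis by simp
  qed
  have "(3 / 4) ^ K = (3 / 4 :: real) powr K"
    by (simp add: powr_realpow)
  also have "\<dots> \<le> (3 / 4) powr (3 * L + 29)"
    using K by (intro powr_mono') auto
  also have "\<dots> = ((3 / 4) powr 3) powr L * (3 / 4) powr 29"
    by (simp only: powr_add powr_powr)
  also have "\<dots> \<le> (1 / 2) powr L * (1 / 100)"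
  proof (intro mult_mono powr_mono2)
    show "(3 / 4 :: real) powr 29 \<le> 1 / 100"
      using powr_realpow[of "3 / 4 :: real" 29] by (simp add: power_divide)
    show "(3 / 4 :: real) powr 3 \<le> 1 / 2"
      using powr_realpow[of "3 / 4 :: real" 3] by (simp add: power_divide)
  qed (use L in auto)
  also have "(1 / 2) powr L = 1 / real n"
    using L(2) by (simp add: powr_divide)
  finally show ?thesis
    using False by (simp add: K_def L_def field_simps)
qed simp

theorem theorem1:
  fixes V :: "'v set" and n :: nat
  assumes "finite V" and "card V = n"
  shows "\<exists>alg :: 'v randomized_algorithm.
    (\<forall>D \<in> set_pmf alg.
        makes_calls D (nat \<lfloor>3 * (log 2 (real n) + 10)\<rfloor>) \<and>
        all_calls (\<lambda>R S \<delta>. R \<subseteq> V \<and> S \<subseteq> V \<and> R \<inter> S = {} \<and>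
                          \<delta> = inverse (300 * (log 2 (real n) + 10))) D) \<and>
    (\<forall>w rofa. weighted_graph V w \<longrightarrow> RecoverOneFromAll (adjacency_matrix w) V V rofa \<longrightarrow>
        measure_pmf.prob (run_randomized rofa alg) {F. spanning_forest V w F} \<ge> 49 / 50)"
proof -
  define L where "L = log 2 (real n)"
  define K where "K = nat \<lfloor>3 * (L + 10)\<rfloor>"
  define \<delta> where "\<delta> = inverse (300 * (L + 10))"
  define alg where "alg = map_pmf (\<lambda>Us. boruvka V \<delta> Us {}) (replicate_pmf K (pmf_of_set (Pow V)))"
  \<comment> \<open>For \<open>n = 0\<close> the logarithm is 0 by the convention
    \<open>ln 0 = 0\<close>.\<close>
  have L: "0 \<le> L"
    by (cases "n = 0") (auto simp: L_def log_def)
  have \<delta>: "0 < \<delta>"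
    using L by (simp add: \<delta>_def)
  \<comment> \<open>The 300 in \<open>\<delta>\<close> is 3 times 100: the 3 cancels against the
    number of calls.\<close>
  have "K * \<delta> \<le> 3 * (L + 10) * \<delta>"
    using L \<delta> by (intro mult_right_mono) (auto simp: K_def)
  also have "\<dots> = 1 / 100"
    using L by (simp add: \<delta>_def field_simps)
  finally have calls: "K * \<delta> \<le> 1 / 100" .
  have "makes_calls D K \<and> all_calls (\<lambda>R S \<delta>'. R \<subseteq> V \<and> S \<subseteq> V \<and> R \<inter> S = {} \<and> \<delta>' = \<delta>) D"
    if "D \<in> set_pmf alg" for D
    using that makes_calls_boruvka[of V \<delta>] all_calls_boruvka[of V \<delta>]
    by (auto simp: alg_def set_replicate_pmf)
  moreover have "measure_pmf.prob (run_randomized rofa alg) {F. spanning_forest V w F} \<ge> 49 / 50"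
    if rofa: "RecoverOneFromAll (adjacency_matrix w) V V rofa" for w rofa
  proof -
    let ?O = "open_components V (edges V w) {}"
    have "measure_pmf.prob (run_randomized rofa alg) {F. \<not> spanning_forest V w F}
        \<le> K * \<delta> + (3 / 4) ^ K * card ?O"
      using boruvka_failure[OF assms(1) \<delta> rofa, of "{}" K]
      by (simp add: run_randomized_def alg_def bind_map_pmf)
    also have "\<dots> \<le> 1 / 100 + (3 / 4) ^ K * n"
      using calls card_open_components_le[OF assms(1), of "edges V w" "{}"] assms(2)
      by (intro add_mono mult_left_mono) auto
    also have "\<dots> \<le> 1 / 50"
      using rounds_suffice[of n] by (simp add: K_def L_def)
    finally show ?thesis
      using measure_pmf.prob_compl[of "{F. spanning_forest V w F}" "run_randomized rofa alg"]
      by (simp add: Compl_eq_Diff_UNIV[symmetric] Collect_neg_eq)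
  qed
  ultimately show ?thesis
    unfolding K_def \<delta>_def L_def by blast
qed

end
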